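(* Let a point-free relation algebra be given. Let $P,Q$ range over the pers of the algebra, and write $\mathsf{minimal}.P$ for "the per $P$ is minimal with respect to the thins ordering $\preceq$ on pers (of the type of $P$)". Then the axiom of choice (every per has an index) is equivalent to $$\big\langle \forall P :: \mathsf{minimal}.P \equiv P\subseteq \mathbb{I}\big\rangle \;\wedge\; \big\langle \forall Q :: \langle \exists P : \mathsf{minimal}.P : P\preceq Q\rangle\big\rangle .$$
   Context: A point-free relation algebra consists of the following. There is a non-empty set of basic types; each element (relation) $X$ has a type $A\sim B$ for basic types $A,B$. Monoid structure: for $X$ of type $A\sim B$ and $Y$ of type $B\sim C$ there is a composition $X\circ Y$ of type $A\sim C$; composition is associative, and for each basic type $A$ there is an identity $\mathbb{I}$ of type $A\sim A$ which is a unit of composition. Lattice structure: the relations of each type $A\sim B$ form a (finitely) distributive lattice ordered by $\subseteq$ with join $\cup$, meet $\cap$, least element $\bot$ and greatest element $\top$ (types of $\mathbb{I},\bot,\top$ are deduced from context). Factors: there are operators $\setminus$ and $/$ with $(Y\subseteq X\setminus Z)\equiv (X\circ Y\subseteq Z)\equiv (X\subseteq Z/Y)$. Converse: for each $X$ of type $A\sim B$ there is $X^{\smile}$ of type $B\sim A$, with $X^{\smile}\subseteq Y\equiv X\subseteq Y^{\smile}$, $\mathbb{I}^{\smile}=\mathbb{I}$, $(X\circ Y)^{\smile}=Y^{\smile}\circ X^{\smile}$. Modularity law: $X\circ Y\cap Z\subseteq X\circ(Y\cap X^{\smile}\circ Z)$. Complements and the cone rule ($\top\circ X\circ\top=\top\equiv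 X\neq\bot$) are not assumed. A per is a relation $P$ (of some type $A\sim A$) with $P=P^{\smile}$ and $P\circ P\subseteq P$. For a per $P$, $\mathrm{dom}(P)=\mathbb{I}\cap P$ is its (left and right) domain. Thins: for pers $P,Q$ of the same type, $P\preceq Q$ iff $P=\mathrm{dom}(P)\circ Q\circ \mathrm{dom}(P)$ and $Q=Q\circ \mathrm{dom}(P)\circ Q$. This relation is a partial ordering on pers. A per $Q$ is minimal iff for all pers $P$, $P\preceq Q$ implies $P=Q$. An index of a per $P$ is a relation $J$ with (a) $J\subseteq \mathrm{dom}(P)$, (b) $J\circ P\circ J=J$, (c) $P\circ J\circ P=P$. The axiom of choice is the statement: every per has an index. *)

theory Defs
  imports "HOL-Algebra.Lattice"
begin

text \<open>
  Relations are heterogeneous: \<open>rels R A B\<close> is the ordered set of the relations of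
  type \<open>A \<sim> B\<close>. Its order, join, meet, bottom and top are those of the relation
  algebra at that type.  The operators are total functions on the type of relations, but only
  their values on arguments of matching types are constrained.
\<close>

record ('t, 'r) rel_structure =
  types :: "'t set"
  rels :: "'t \<Rightarrow> 't \<Rightarrow> 'r gorder"
  rcomp :: "'r \<Rightarrow> 'r \<Rightarrow> 'r"  (infixl \<open>\<odot>\<index>\<close> 75)
  ident :: "'t \<Rightarrow> 'r"  (\<open>\<I>\<index>\<close>)
  conv :: "'r \<Rightarrow> 'r"  (\<open>(_\<^sup>\<smile>\<index>)\<close> [1000] 1000)
  lfactor :: "'r \<Rightarrow> 'r \<Rightarrow> 'r"  (infixl \<open>\<setminus>\<index>\<close> 72)
  rfactor :: "'r \<Rightarrow> 'r \<Rightarrow> 'r"  (infixl \<open>\<sslash>\<index>\<close> 72)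

locale pointfree_relation_algebra =
  fixes R :: "('t, 'r) rel_structure" (structure)
  assumes types_nonempty: "types R \<noteq> {}"
    and type_unique:
      "\<lbrakk>A \<in> types R; B \<in> types R; C \<in> types R; D \<in> types R;
        X \<in> carrier (rels R A B); X \<in> carrier (rels R C D)\<rbrakk> \<Longrightarrow> A = C \<and> B = D"
    and comp_closed:
      "\<lbrakk>A \<in> types R; B \<in> types R; C \<in> types R;
        X \<in> carrier (rels R A B); Y \<in> carrier (rels R B C)\<rbrakk> \<Longrightarrow> X \<odot> Y \<in> carrier (rels R A C)"
    and comp_assoc:
      "\<lbrakk>A \<in> types R; B \<in> types R; C \<in> types R; D \<in> types R;
        X \<in> carrier (rels R A B); Y \<in> carrier (rels R B C); Z \<in> carrier (rels R C D)\<rbrakk>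
        \<Longrightarrow> (X \<odot> Y) \<odot> Z = X \<odot> (Y \<odot> Z)"
    and ident_closed: "A \<in> types R \<Longrightarrow> \<I> A \<in> carrier (rels R A A)"
    and ident_left:
      "\<lbrakk>A \<in> types R; B \<in> types R; X \<in> carrier (rels R A B)\<rbrakk> \<Longrightarrow> \<I> A \<odot> X = X"
    and ident_right:
      "\<lbrakk>A \<in> types R; B \<in> types R; X \<in> carrier (rels R A B)\<rbrakk> \<Longrightarrow> X \<odot> \<I> B = X"
    and rels_bounded_lattice:
      "\<lbrakk>A \<in> types R; B \<in> types R\<rbrakk> \<Longrightarrow> bounded_lattice (rels R A B)"
    and rels_distributive:
      "\<lbrakk>A \<in> types R; B \<in> types R;
        X \<in> carrier (rels R A B); Y \<in> carrier (rels R A B); Z \<in> carrier (rels R A B)\<rbrakk>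
        \<Longrightarrow> X \<sqinter>\<^bsub>rels R A B\<^esub> (Y \<squnion>\<^bsub>rels R A B\<^esub> Z) =
            (X \<sqinter>\<^bsub>rels R A B\<^esub> Y) \<squnion>\<^bsub>rels R A B\<^esub> (X \<sqinter>\<^bsub>rels R A B\<^esub> Z)"
    and lfactor_closed:
      "\<lbrakk>A \<in> types R; B \<in> types R; C \<in> types R;
        X \<in> carrier (rels R A B); Z \<in> carrier (rels R A C)\<rbrakk> \<Longrightarrow> X \<setminus> Z \<in> carrier (rels R B C)"
    and rfactor_closed:
      "\<lbrakk>A \<in> types R; B \<in> types R; C \<in> types R;
        Z \<in> carrier (rels R A C); Y \<in> carrier (rels R B C)\<rbrakk> \<Longrightarrow> Z \<sslash> Y \<in> carrier (rels R A B)"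
    and lfactor_galois:
      "\<lbrakk>A \<in> types R; B \<in> types R; C \<in> types R;
        X \<in> carrier (rels R A B); Y \<in> carrier (rels R B C); Z \<in> carrier (rels R A C)\<rbrakk>
        \<Longrightarrow> Y \<sqsubseteq>\<^bsub>rels R B C\<^esub> X \<setminus> Z \<longleftrightarrow> X \<odot> Y \<sqsubseteq>\<^bsub>rels R A C\<^esub> Z"
    and rfactor_galois:
      "\<lbrakk>A \<in> types R; B \<in> types R; C \<in> types R;
        X \<in> carrier (rels R A B); Y \<in> carrier (rels R B C); Z \<in> carrier (rels R A C)\<rbrakk>
        \<Longrightarrow> X \<odot> Y \<sqsubseteq>\<^bsub>rels R A C\<^esub> Z \<longleftrightarrow> X \<sqsubseteq>\<^bsub>rels R A B\<^esub> Z \<sslash> Y"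
    and conv_closed:
      "\<lbrakk>A \<in> types R; B \<in> types R; X \<in> carrier (rels R A B)\<rbrakk> \<Longrightarrow> X\<^sup>\<smile> \<in> carrier (rels R B A)"
    and conv_galois:
      "\<lbrakk>A \<in> types R; B \<in> types R; X \<in> carrier (rels R A B); Y \<in> carrier (rels R B A)\<rbrakk>
        \<Longrightarrow> X\<^sup>\<smile> \<sqsubseteq>\<^bsub>rels R B A\<^esub> Y \<longleftrightarrow> X \<sqsubseteq>\<^bsub>rels R A B\<^esub> Y\<^sup>\<smile>"
    and conv_ident: "A \<in> types R \<Longrightarrow> (\<I> A)\<^sup>\<smile> = \<I> A"
    and conv_comp:
      "\<lbrakk>A \<in> types R; B \<in> types R; C \<in> types R;
        X \<in> carrier (rels R A B); Y \<in> carrier (rels R B C)\<rbrakk> \<Longrightarrow> (X \<odot> Y)\<^sup>\<smile> = Y\<^sup>\<smile> \<odot> X\<^sup>\<smile>"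
    and modularity:
      "\<lbrakk>A \<in> types R; B \<in> types R; C \<in> types R;
        X \<in> carrier (rels R A B); Y \<in> carrier (rels R B C); Z \<in> carrier (rels R A C)\<rbrakk>
        \<Longrightarrow> (X \<odot> Y) \<sqinter>\<^bsub>rels R A C\<^esub> Z
              \<sqsubseteq>\<^bsub>rels R A C\<^esub> X \<odot> (Y \<sqinter>\<^bsub>rels R B C\<^esub> (X\<^sup>\<smile> \<odot> Z))"

definition per :: "('t, 'r) rel_structure \<Rightarrow> 't \<Rightarrow> 'r \<Rightarrow> bool" where
  "per R A P \<longleftrightarrow> A \<in> types R \<and> P \<in> carrier (rels R A A) \<and>
     P = P\<^sup>\<smile>\<^bsub>R\<^esub> \<and> P \<odot>\<^bsub>R\<^esub> P \<sqsubseteq>\<^bsub>rels R A A\<^esub> P"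

definition per_dom :: "('t, 'r) rel_structure \<Rightarrow> 't \<Rightarrow> 'r \<Rightarrow> 'r" where
  "per_dom R A P = \<I>\<^bsub>R\<^esub> A \<sqinter>\<^bsub>rels R A A\<^esub> P"

definition thins :: "('t, 'r) rel_structure \<Rightarrow> 't \<Rightarrow> 'r \<Rightarrow> 'r \<Rightarrow> bool" where
  "thins R A P Q \<longleftrightarrow> per R A P \<and> per R A Q \<and>
     P = per_dom R A P \<odot>\<^bsub>R\<^esub> Q \<odot>\<^bsub>R\<^esub> per_dom R A P \<and>
     Q = Q \<odot>\<^bsub>R\<^esub> per_dom R A P \<odot>\<^bsub>R\<^esub> Q"

definition minimal_per :: "('t, 'r) rel_structure \<Rightarrow> 't \<Rightarrow> 'r \<Rightarrow> bool" where
  "minimal_per R A Q \<longleftrightarrow> per R A Q \<and> (\<forall>P. per R A P \<longrightarrow> thins R A P Q \<longrightarrow> P = Q)"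

definition index_of :: "('t, 'r) rel_structure \<Rightarrow> 't \<Rightarrow> 'r \<Rightarrow> 'r \<Rightarrow> bool" where
  "index_of R A J P \<longleftrightarrow> J \<in> carrier (rels R A A) \<and>
     J \<sqsubseteq>\<^bsub>rels R A A\<^esub> per_dom R A P \<and>
     J \<odot>\<^bsub>R\<^esub> P \<odot>\<^bsub>R\<^esub> J = J \<and>
     P \<odot>\<^bsub>R\<^esub> J \<odot>\<^bsub>R\<^esub> P = P"

definition axiom_of_choice :: "('t, 'r) rel_structure \<Rightarrow> bool" where
  "axiom_of_choice R \<longleftrightarrow>
     (\<forall>A\<in>types R. \<forall>P. per R A P \<longrightarrow> (\<exists>J. index_of R A J P))"

end

theory Submission
  imports Defs
begin

text \<open>
  A coreflexive relation is a per that is its own domain, so a coreflexive \<open>J\<close> thins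
  \<open>P\<close> exactly when \<open>J\<close> is an index of \<open>P\<close>. A per thinning a
  coreflexive \<open>P\<close> is itself coreflexive, and the two thinning equations then sandwich it to
  \<open>P\<close>; hence coreflexives are minimal. Both directions follow: an index thins its per to a
  coreflexive, and conversely a minimal per thinning \<open>Q\<close> is coreflexive, thus an index of
  \<open>Q\<close>.
\<close>

lemma per_carrier:
  assumes "per R A P"
  shows "A \<in> types R" and "P \<in> carrier (rels R A A)"
  using assms unfolding per_def by blast+

lemma thins_per: "thins R A P Q \<Longrightarrow> per R A P"
  unfolding thins_def by blast

text \<open>In \<open>thins\<close> the per \<open>P\<close> occurs on both sides of its own
  equation; the composites stand on the left here so that they rewrite to \<open>P\<close> and
  \<open>Q\<close>.\<close>

lemma thins_eqs:
  assumes "thins R A P Q"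
  shows "per_dom R A P \<odot>\<^bsub>R\<^esub> Q \<odot>\<^bsub>R\<^esub> per_dom R A P = P"
    and "Q \<odot>\<^bsub>R\<^esub> per_dom R A P \<odot>\<^bsub>R\<^esub> Q = Q"
  using assms unfolding thins_def by metis+

context pointfree_relation_algebra
begin

text \<open>Each argument is handled separately through its factor: composition with a fixed
  relation is a lower adjoint, hence monotone.\<close>

lemma comp_mono:
  assumes "A \<in> types R" "B \<in> types R" "C \<in> types R"
    and X: "X \<in> carrier (rels R A B)" "X' \<in> carrier (rels R A B)" "X \<sqsubseteq>\<^bsub>rels R A B\<^esub> X'"
    and Y: "Y \<in> carrier (rels R B C)" "Y' \<in> carrier (rels R B C)" "Y \<sqsubseteq>\<^bsub>rels R B C\<^esub> Y'"
  shows "X \<odot> Y \<sqsubseteq>\<^bsub>rels R A C\<^esub> X' \<odot> Y'"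
proof -
  interpret AB: bounded_lattice "rels R A B" by (rule rels_bounded_lattice) fact+
  interpret BC: bounded_lattice "rels R B C" by (rule rels_bounded_lattice) fact+
  interpret AC: bounded_lattice "rels R A C" by (rule rels_bounded_lattice) fact+
  have c: "X \<odot> Y \<in> carrier (rels R A C)" "X' \<odot> Y \<in> carrier (rels R A C)"
    "X' \<odot> Y' \<in> carrier (rels R A C)"
    using assms by (auto intro: comp_closed)
  have d: "(X' \<odot> Y) \<sslash> Y \<in> carrier (rels R A B)"
    "X' \<setminus> (X' \<odot> Y') \<in> carrier (rels R B C)"
    using assms c by (auto intro: lfactor_closed rfactor_closed)
  \<comment> \<open>The unit of the Galois connection, from reflexivity at
    \<open>X' \<odot> Y\<close>. The inclusion of \<open>X\<close> in \<open>X'\<close> extends it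
    to \<open>X\<close>, and the connection then carries \<open>Y\<close> back to the left.\<close>
  have "X' \<sqsubseteq>\<^bsub>rels R A B\<^esub> (X' \<odot> Y) \<sslash> Y"
    using rfactor_galois [of A B C X' Y "X' \<odot> Y"] assms c by simp
  then have "X \<sqsubseteq>\<^bsub>rels R A B\<^esub> (X' \<odot> Y) \<sslash> Y"
    using AB.le_trans [OF X(3)] X d by simp
  then have 1: "X \<odot> Y \<sqsubseteq>\<^bsub>rels R A C\<^esub> X' \<odot> Y"
    using rfactor_galois [of A B C X Y "X' \<odot> Y"] assms c by simp
  have "Y' \<sqsubseteq>\<^bsub>rels R B C\<^esub> X' \<setminus> (X' \<odot> Y')"
    using lfactor_galois [of A B C X' Y' "X' \<odot> Y'"] assms c by simp
  then have "Y \<sqsubseteq>\<^bsub>rels R B C\<^esub> X' \<setminus> (X' \<odot> Y')"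
    using BC.le_trans [OF Y(3)] Y d by simp
  then have 2: "X' \<odot> Y \<sqsubseteq>\<^bsub>rels R A C\<^esub> X' \<odot> Y'"
    using lfactor_galois [of A B C X' Y "X' \<odot> Y'"] assms c by simp
  show ?thesis
    using AC.le_trans [OF 1 2] c by simp
qed

lemma coreflexive_comp_le:
  assumes A: "A \<in> types R"
    and J: "J \<in> carrier (rels R A A)" "J \<sqsubseteq>\<^bsub>rels R A A\<^esub> \<I> A"
    and X: "X \<in> carrier (rels R A A)"
  shows "J \<odot> X \<sqsubseteq>\<^bsub>rels R A A\<^esub> X" and "X \<odot> J \<sqsubseteq>\<^bsub>rels R A A\<^esub> X"
proof -
  interpret bounded_lattice "rels R A A" by (rule rels_bounded_lattice) fact+
  show "J \<odot> X \<sqsubseteq>\<^bsub>rels R A A\<^esub> X"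
    using comp_mono [of A A A J "\<I> A" X X] assms ident_closed ident_left by auto
  show "X \<odot> J \<sqsubseteq>\<^bsub>rels R A A\<^esub> X"
    using comp_mono [of A A A X X J "\<I> A"] assms ident_closed ident_right by auto
qed

lemma le_comp_conv_comp:
  assumes A: "A \<in> types R" and X: "X \<in> carrier (rels R A A)"
  shows "X \<sqsubseteq>\<^bsub>rels R A A\<^esub> X \<odot> (X\<^sup>\<smile> \<odot> X)"
proof -
  interpret bounded_lattice "rels R A A" by (rule rels_bounded_lattice) fact+
  have I: "\<I> A \<in> carrier (rels R A A)" and c: "X\<^sup>\<smile> \<odot> X \<in> carrier (rels R A A)"
    using A X by (auto intro: ident_closed conv_closed comp_closed)
  \<comment> \<open>Inserting the identity brings \<open>X\<close> into the shape of the modularity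
    law, with \<open>\<I> A\<close> as second factor and \<open>X\<close> itself as the relation met
    with the product.\<close>
  have "X \<sqsubseteq>\<^bsub>rels R A A\<^esub> (X \<odot> \<I> A) \<sqinter>\<^bsub>rels R A A\<^esub> X"
    using A X by (simp add: ident_right meet_le)
  also have "\<dots> \<sqsubseteq>\<^bsub>rels R A A\<^esub> X \<odot> (\<I> A \<sqinter>\<^bsub>rels R A A\<^esub> (X\<^sup>\<smile> \<odot> X))"
    using A X I by (intro modularity)
  also have "\<dots> \<sqsubseteq>\<^bsub>rels R A A\<^esub> X \<odot> (X\<^sup>\<smile> \<odot> X)"
    using A X I c by (intro comp_mono) (auto intro: meet_right)
  finally show ?thesis
    using A X I c by (simp add: comp_closed)
qed

lemma coreflexive_per:
  assumes A: "A \<in> types R"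
    and J: "J \<in> carrier (rels R A A)" "J \<sqsubseteq>\<^bsub>rels R A A\<^esub> \<I> A"
  shows "per R A J"
proof -
  interpret bounded_lattice "rels R A A" by (rule rels_bounded_lattice) fact+
  have c: "J\<^sup>\<smile> \<in> carrier (rels R A A)" "J\<^sup>\<smile> \<odot> J \<in> carrier (rels R A A)"
    using A J by (auto intro: conv_closed comp_closed)
  have "J \<sqsubseteq>\<^bsub>rels R A A\<^esub> J \<odot> (J\<^sup>\<smile> \<odot> J)"
    using A J by (intro le_comp_conv_comp)
  also have "\<dots> \<sqsubseteq>\<^bsub>rels R A A\<^esub> J\<^sup>\<smile> \<odot> J"
    using A J c by (intro coreflexive_comp_le)
  also have "\<dots> \<sqsubseteq>\<^bsub>rels R A A\<^esub> J\<^sup>\<smile>"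
    using A J c by (intro coreflexive_comp_le)
  finally have le: "J \<sqsubseteq>\<^bsub>rels R A A\<^esub> J\<^sup>\<smile>"
    using A J c by (simp add: comp_closed)
  \<comment> \<open>With both arguments equal to \<open>J\<close>, the Galois connection of converse
    makes the two inclusions equivalent.\<close>
  moreover have "J\<^sup>\<smile> \<sqsubseteq>\<^bsub>rels R A A\<^esub> J"
    using le A J by (simp add: conv_galois)
  ultimately have "J = J\<^sup>\<smile>"
    using J c by (intro le_antisym)
  then show ?thesis
    unfolding per_def using A J coreflexive_comp_le by blast
qed

lemma per_dom_le:
  assumes "per R A P"
  shows "per_dom R A P \<in> carrier (rels R A A)"
    and "per_dom R A P \<sqsubseteq>\<^bsub>rels R A A\<^esub> \<I> A"
    and "per_dom R A P \<sqsubseteq>\<^bsub>rels R A A\<^esub> P"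
proof -
  have A: "A \<in> types R" and P: "P \<in> carrier (rels R A A)"
    using per_carrier [OF assms] .
  interpret bounded_lattice "rels R A A" by (rule rels_bounded_lattice) fact+
  show "per_dom R A P \<in> carrier (rels R A A)"
    "per_dom R A P \<sqsubseteq>\<^bsub>rels R A A\<^esub> \<I> A" "per_dom R A P \<sqsubseteq>\<^bsub>rels R A A\<^esub> P"
    using P ident_closed [OF A] by (auto simp: per_dom_def intro: meet_left meet_right)
qed

lemma per_dom_coreflexive:
  assumes A: "A \<in> types R"
    and J: "J \<in> carrier (rels R A A)" "J \<sqsubseteq>\<^bsub>rels R A A\<^esub> \<I> A"
  shows "per_dom R A J = J"
proof -
  interpret bounded_lattice "rels R A A" by (rule rels_bounded_lattice) fact+
  show ?thesis
    unfolding per_dom_def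
    using J ident_closed [OF A] by (intro le_antisym) (auto intro: meet_right meet_le)
qed

text \<open>This turns a thinning equation or an index equation, whose left side is such a sandwich,
  into an inclusion.\<close>

lemma coreflexive_sandwich_le:
  assumes A: "A \<in> types R"
    and J: "J \<in> carrier (rels R A A)" "J \<sqsubseteq>\<^bsub>rels R A A\<^esub> \<I> A"
    and X: "X \<in> carrier (rels R A A)"
  shows "J \<odot> X \<odot> J \<sqsubseteq>\<^bsub>rels R A A\<^esub> X"
proof -
  interpret bounded_lattice "rels R A A" by (rule rels_bounded_lattice) fact+
  have c: "J \<odot> X \<in> carrier (rels R A A)" "J \<odot> X \<odot> J \<in> carrier (rels R A A)"
    using A J X by (auto intro!: comp_closed)
  have "J \<odot> X \<odot> J \<sqsubseteq>\<^bsub>rels R A A\<^esub> J \<odot> X"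
    using A J c by (intro coreflexive_comp_le)
  also have "\<dots> \<sqsubseteq>\<^bsub>rels R A A\<^esub> X"
    using A J X by (intro coreflexive_comp_le)
  finally show ?thesis
    using c X by simp
qed

text \<open>As \<open>J\<close> equals its own domain, the two thinning equations are literally the
  index equations. What remains is to match the bound by \<open>per_dom R A P\<close> with the bound
  by the identity.\<close>

lemma index_iff_coreflexive_thins:
  assumes P: "per R A P"
  shows "index_of R A J P \<longleftrightarrow> J \<sqsubseteq>\<^bsub>rels R A A\<^esub> \<I> A \<and> thins R A J P"
proof -
  have A: "A \<in> types R" and Pc: "P \<in> carrier (rels R A A)"
    using per_carrier [OF P] .
  interpret bounded_lattice "rels R A A" by (rule rels_bounded_lattice) fact+
  note dom = per_dom_le [OF P]
  have I: "\<I> A \<in> carrier (rels R A A)"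
    using A by (rule ident_closed)
  show ?thesis
  proof
    assume J: "index_of R A J P"
    then have Jc: "J \<in> carrier (rels R A A)" and "J \<sqsubseteq>\<^bsub>rels R A A\<^esub> per_dom R A P"
      by (auto simp: index_of_def)
    then have JI: "J \<sqsubseteq>\<^bsub>rels R A A\<^esub> \<I> A"
      using le_trans [OF _ dom(2)] dom(1) I by simp
    have "J \<odot> P \<odot> J = J" "P \<odot> J \<odot> P = P"
      using J by (auto simp: index_of_def)
    then have "thins R A J P"
      using P coreflexive_per [OF A Jc JI] per_dom_coreflexive [OF A Jc JI]
      by (simp add: thins_def)
    with JI show "J \<sqsubseteq>\<^bsub>rels R A A\<^esub> \<I> A \<and> thins R A J P" ..
  next
    assume J: "J \<sqsubseteq>\<^bsub>rels R A A\<^esub> \<I> A \<and> thins R A J P"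
    then have JI: "J \<sqsubseteq>\<^bsub>rels R A A\<^esub> \<I> A" and thin: "thins R A J P"
      by auto
    have Jc: "J \<in> carrier (rels R A A)"
      using thins_per [OF thin] by (rule per_carrier)
    have eqs: "J \<odot> P \<odot> J = J" "P \<odot> J \<odot> P = P"
      using thins_eqs [OF thin] per_dom_coreflexive [OF A Jc JI] by simp_all
    \<comment> \<open>The equation \<open>J \<odot> P \<odot> J = J\<close> supplies the missing
      half of the domain bound.\<close>
    have "J \<sqsubseteq>\<^bsub>rels R A A\<^esub> P"
      using coreflexive_sandwich_le [OF A Jc JI Pc] eqs by simp
    then have "J \<sqsubseteq>\<^bsub>rels R A A\<^esub> per_dom R A P"
      unfolding per_dom_def using Jc JI Pc I by (intro meet_le)
    then show "index_of R A J P"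
      using Jc eqs by (simp add: index_of_def)
  qed
qed

lemma coreflexive_minimal:
  assumes A: "A \<in> types R"
    and P: "P \<in> carrier (rels R A A)" "P \<sqsubseteq>\<^bsub>rels R A A\<^esub> \<I> A"
  shows "minimal_per R A P"
  unfolding minimal_per_def
proof (intro conjI allI impI)
  show "per R A P"
    using A P by (rule coreflexive_per)
next
  fix Q
  assume Q: "per R A Q" and thin: "thins R A Q P"
  interpret bounded_lattice "rels R A A" by (rule rels_bounded_lattice) fact+
  note dom = per_dom_le [OF Q]
  have Qc: "Q \<in> carrier (rels R A A)"
    using Q by (rule per_carrier)
  \<comment> \<open>The first thinning equation is a sandwich of \<open>P\<close> between copies of
    the coreflexive \<open>per_dom R A Q\<close>.\<close>
  have QP: "Q \<sqsubseteq>\<^bsub>rels R A A\<^esub> P"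
    using coreflexive_sandwich_le [OF A dom(1,2) P(1)] thins_eqs(1) [OF thin] by simp
  have QI: "Q \<sqsubseteq>\<^bsub>rels R A A\<^esub> \<I> A"
    using le_trans [OF QP P(2)] Qc P ident_closed [OF A] by simp
  \<comment> \<open>Now that \<open>Q\<close> is known to be coreflexive, its domain in the second
    thinning equation is \<open>Q\<close> itself. The roles are thus exchanged: \<open>Q\<close> is
    sandwiched between copies of the coreflexive \<open>P\<close>.\<close>
  have "P \<odot> Q \<odot> P = P"
    using thins_eqs(2) [OF thin] per_dom_coreflexive [OF A Qc QI] by simp
  then have "P \<sqsubseteq>\<^bsub>rels R A A\<^esub> Q"
    using coreflexive_sandwich_le [OF A P Qc] by simp
  with QP show "Q = P"
    using Qc P by (intro le_antisym)
qed

end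

theorem theorem24:
  fixes R :: "('t, 'r) rel_structure"
  assumes "pointfree_relation_algebra R"
  shows "axiom_of_choice R \<longleftrightarrow>
    (\<forall>A\<in>types R. \<forall>P. per R A P \<longrightarrow>
        (minimal_per R A P \<longleftrightarrow> P \<sqsubseteq>\<^bsub>rels R A A\<^esub> \<I>\<^bsub>R\<^esub> A)) \<and>
    (\<forall>A\<in>types R. \<forall>Q. per R A Q \<longrightarrow>
        (\<exists>P. per R A P \<and> minimal_per R A P \<and> thins R A P Q))"
    (is "_ \<longleftrightarrow> ?coreflexive \<and> ?thinned")
proof -
  interpret pointfree_relation_algebra R by fact
  have minimal: "minimal_per R A P" if "per R A P" "P \<sqsubseteq>\<^bsub>rels R A A\<^esub> \<I>\<^bsub>R\<^esub> A" for A P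
    using per_carrier [OF that(1)] that(2) by (rule coreflexive_minimal)
  show ?thesis
  proof
    assume AC: "axiom_of_choice R"
    show "?coreflexive \<and> ?thinned"
    proof (intro conjI ballI allI impI)
      fix A P
      assume "A \<in> types R" and P: "per R A P"
      then obtain J where "index_of R A J P"
        using AC by (auto simp: axiom_of_choice_def)
      then have J: "J \<sqsubseteq>\<^bsub>rels R A A\<^esub> \<I>\<^bsub>R\<^esub> A" "thins R A J P"
        using index_iff_coreflexive_thins [OF P] by auto
      note perJ = thins_per [OF J(2)]
      \<comment> \<open>If \<open>P\<close> is minimal, the index \<open>J\<close> that thins it
        must equal \<open>P\<close>, so \<open>P\<close> inherits coreflexivity from
        \<open>J\<close>.\<close>
      show "minimal_per R A P \<longleftrightarrow> P \<sqsubseteq>\<^bsub>rels R A A\<^esub> \<I>\<^bsub>R\<^esub> A"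
        using J P perJ minimal [OF P] unfolding minimal_per_def by blast
      show "\<exists>Q. per R A Q \<and> minimal_per R A Q \<and> thins R A Q P"
        using J perJ minimal [OF perJ J(1)] by blast
    qed
  next
    assume minimals: "?coreflexive \<and> ?thinned"
    show "axiom_of_choice R"
      unfolding axiom_of_choice_def
    proof (intro ballI allI impI)
      fix A Q
      assume "A \<in> types R" and Q: "per R A Q"
      then obtain P where "per R A P" "minimal_per R A P" "thins R A P Q"
        using minimals by blast
      \<comment> \<open>The first conjunct makes the minimal \<open>P\<close> coreflexive, so the
        thinning witness is already the index.\<close>
      then have "index_of R A P Q"
        using minimals \<open>A \<in> types R\<close> index_iff_coreflexive_thins [OF Q] by simp
      then show "\<exists>J. index_of R A J Q" ..
    qed
  qed
qed

end
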